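(* Let $K$ be a commutative ring with identity, $n\ge 0$, and let $B,C$ be monoids such that $C$ is a retract of $B$, i.e. there are monoid homomorphisms $\psi:B\to C$ and $\phi:C\to B$ with $\psi\phi=\mathrm{id}_C$. If $B$ is left-$FP_n$ (resp. right-$FP_n$, bi-$FP_n$, weak bi-$FP_n$) over $K$, then so is $C$.
   Context: For a monoid $B$, $KB$ is the monoid ring with augmentation $\varepsilon:KB\to K$, $b\mapsto 1$. A module is of type $FP_n$ if there is an exact sequence $0\leftarrow M\leftarrow P_0\leftarrow\cdots\leftarrow P_n$ with $P_0,\dots,P_n$ finitely generated free modules. $B$ is left-$FP_n$ (resp. right-$FP_n$) if $K$ as a left (resp. right) $KB$-module via $\varepsilon$ is of type $FP_n$. $(KB,KB)$-bimodules are abelian groups with commuting left and right actions and $km=mk$ for $k\in K$; the free bimodule of rank $r$ is a direct sum of $r$ copies of $KB\otimes_K KB$ (action $a(u\otimes v)b=au\otimes vb$). $B$ is weak bi-$FP_n$ if the bimodule $K$ (action $a\cdot k\cdot a'=\varepsilon(a)k\varepsilon(a')$) has a partial resolution $0\leftarrow K\leftarrow F_0\leftarrow\cdots\leftarrow F_n$ by finitely generated free bimodules; $B$ is bi-$FP_n$ if the bimodule $KB$ (left and right multiplication) has such a partial resolution $0\leftarrow KB\leftarrow F_0\leftarrow\cdots\leftarrow F_n$. *)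

theory Defs
  imports Main "HOL-Library.Function_Algebras"
begin

definition monring :: "('b::monoid_mult \<Rightarrow> 'k::comm_ring_1) set" where
  "monring = {f. finite {x. f x \<noteq> 0}}"

definition supp_fn :: "('a \<Rightarrow> 'k::zero) \<Rightarrow> 'a set" where
  "supp_fn f = {x. f x \<noteq> 0}"

definition mr_mult :: "('b::monoid_mult \<Rightarrow> 'k::comm_ring_1) \<Rightarrow> ('b \<Rightarrow> 'k) \<Rightarrow> ('b \<Rightarrow> 'k)" where
  "mr_mult f g = (\<lambda>x. \<Sum>(u,v)\<in>{(u,v). u \<in> supp_fn f \<and> v \<in> supp_fn g \<and> u * v = x}. f u * g v)"

definition aug :: "('b::monoid_mult \<Rightarrow> 'k::comm_ring_1) \<Rightarrow> 'k" where
  "aug f = (\<Sum>x\<in>supp_fn f. f x)"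

definition is_hom :: "'s set \<Rightarrow> 'p::ab_group_add set \<Rightarrow> ('s \<Rightarrow> 'p \<Rightarrow> 'p)
    \<Rightarrow> 'm::ab_group_add set \<Rightarrow> ('s \<Rightarrow> 'm \<Rightarrow> 'm) \<Rightarrow> ('p \<Rightarrow> 'm) \<Rightarrow> bool" where
  "is_hom S P actP M actM f \<longleftrightarrow>
     (\<forall>x\<in>P. f x \<in> M) \<and> (\<forall>x\<in>P. \<forall>y\<in>P. f (x + y) = f x + f y) \<and>
     (\<forall>s\<in>S. \<forall>x\<in>P. f (actP s x) = actM s (f x))"

text \<open>Existence of an exact sequence 0 <- M <- F(r 0) <- F(r 1) <- ... <- F(r n),
  where F r is the (concrete) finitely generated free module of rank r.\<close>
definition has_FPn_resolution :: "nat \<Rightarrow> 's set \<Rightarrow> (nat \<Rightarrow> 'p::ab_group_add set)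
    \<Rightarrow> ('s \<Rightarrow> 'p \<Rightarrow> 'p) \<Rightarrow> 'm::ab_group_add set \<Rightarrow> ('s \<Rightarrow> 'm \<Rightarrow> 'm) \<Rightarrow> bool" where
  "has_FPn_resolution n S F actF M actM \<longleftrightarrow>
     (\<exists>(r::nat \<Rightarrow> nat) (d0::'p \<Rightarrow> 'm) (d::nat \<Rightarrow> 'p \<Rightarrow> 'p).
        is_hom S (F (r 0)) actF M actM d0 \<and> d0 ` F (r 0) = M \<and>
        (\<forall>i. 1 \<le> i \<and> i \<le> n \<longrightarrow> is_hom S (F (r i)) actF (F (r (i - 1))) actF (d i)) \<and>
        (1 \<le> n \<longrightarrow> d 1 ` F (r 1) = {x \<in> F (r 0). d0 x = 0}) \<and>
        (\<forall>i. 1 \<le> i \<and> i < n \<longrightarrow> d (i + 1) ` F (r (i + 1)) = {x \<in> F (r i). d i x = 0}))"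

definition free_mod :: "nat \<Rightarrow> (nat \<Rightarrow> 'b::monoid_mult \<Rightarrow> 'k::comm_ring_1) set" where
  "free_mod r = {v. (\<forall>i. v i \<in> monring) \<and> (\<forall>i. r \<le> i \<longrightarrow> v i = 0)}"

definition lact :: "('b::monoid_mult \<Rightarrow> 'k::comm_ring_1) \<Rightarrow> (nat \<Rightarrow> 'b \<Rightarrow> 'k) \<Rightarrow> (nat \<Rightarrow> 'b \<Rightarrow> 'k)" where
  "lact a v = (\<lambda>i. mr_mult a (v i))"

definition ract :: "('b::monoid_mult \<Rightarrow> 'k::comm_ring_1) \<Rightarrow> (nat \<Rightarrow> 'b \<Rightarrow> 'k) \<Rightarrow> (nat \<Rightarrow> 'b \<Rightarrow> 'k)" where
  "ract a v = (\<lambda>i. mr_mult (v i) a)"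

text \<open>KB tensor_K KB is identified with the free K-module K[B x B] (basis u (x) v ~ (u,v)),
  with bimodule action a (u (x) v) a' = au (x) va'. The free bimodule of rank r is
  r copies of it.\<close>
definition free_bimod :: "nat \<Rightarrow> (nat \<Rightarrow> ('b::monoid_mult \<times> 'b) \<Rightarrow> 'k::comm_ring_1) set" where
  "free_bimod r = {v. (\<forall>i. finite (supp_fn (v i))) \<and> (\<forall>i. r \<le> i \<longrightarrow> v i = 0)}"

definition tens_act :: "('b::monoid_mult \<Rightarrow> 'k::comm_ring_1) \<times> ('b \<Rightarrow> 'k)
    \<Rightarrow> (('b \<times> 'b) \<Rightarrow> 'k) \<Rightarrow> (('b \<times> 'b) \<Rightarrow> 'k)" where
  "tens_act s w = (\<lambda>(x, y).
     \<Sum>(u, p, q, u')\<in>{(u, p, q, u'). u \<in> supp_fn (fst s) \<and> (p, q) \<in> supp_fn w \<and>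
                         u' \<in> supp_fn (snd s) \<and> u * p = x \<and> q * u' = y}.
       fst s u * w (p, q) * snd s u')"

definition biact :: "('b::monoid_mult \<Rightarrow> 'k::comm_ring_1) \<times> ('b \<Rightarrow> 'k)
    \<Rightarrow> (nat \<Rightarrow> ('b \<times> 'b) \<Rightarrow> 'k) \<Rightarrow> (nat \<Rightarrow> ('b \<times> 'b) \<Rightarrow> 'k)" where
  "biact s v = (\<lambda>i. tens_act s (v i))"

definition left_FP :: "'k::comm_ring_1 itself \<Rightarrow> 'b::monoid_mult itself \<Rightarrow> nat \<Rightarrow> bool" where
  "left_FP _ _ n \<longleftrightarrow>
     has_FPn_resolution n (monring :: ('b \<Rightarrow> 'k) set) free_mod lact
       (UNIV :: 'k set) (\<lambda>a k. aug a * k)"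

definition right_FP :: "'k::comm_ring_1 itself \<Rightarrow> 'b::monoid_mult itself \<Rightarrow> nat \<Rightarrow> bool" where
  "right_FP _ _ n \<longleftrightarrow>
     has_FPn_resolution n (monring :: ('b \<Rightarrow> 'k) set) free_mod ract
       (UNIV :: 'k set) (\<lambda>a k. k * aug a)"

definition weak_bi_FP :: "'k::comm_ring_1 itself \<Rightarrow> 'b::monoid_mult itself \<Rightarrow> nat \<Rightarrow> bool" where
  "weak_bi_FP _ _ n \<longleftrightarrow>
     has_FPn_resolution n (monring \<times> monring :: (('b \<Rightarrow> 'k) \<times> ('b \<Rightarrow> 'k)) set) free_bimod biact
       (UNIV :: 'k set) (\<lambda>s k. aug (fst s) * k * aug (snd s))"

definition bi_FP :: "'k::comm_ring_1 itself \<Rightarrow> 'b::monoid_mult itself \<Rightarrow> nat \<Rightarrow> bool" where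
  "bi_FP _ _ n \<longleftrightarrow>
     has_FPn_resolution n (monring \<times> monring :: (('b \<Rightarrow> 'k) \<times> ('b \<Rightarrow> 'k)) set) free_bimod biact
       (monring :: ('b \<Rightarrow> 'k) set) (\<lambda>s m. mr_mult (mr_mult (fst s) m) (snd s))"

definition monoid_hom :: "('a::monoid_mult \<Rightarrow> 'b::monoid_mult) \<Rightarrow> bool" where
  "monoid_hom f \<longleftrightarrow> f 1 = 1 \<and> (\<forall>x y. f (x * y) = f x * f y)"

end

theory Submission
  imports Defs
begin

text \<open>
  All four properties speak about modules over a monoid algebra \<open>K[M]\<close>, where \<open>M\<close> is \<open>B\<close>, its
  opposite, or \<open>B \<times> B\<^sup>o\<^sup>p\<close>, and a retraction of \<open>B\<close> onto \<open>C\<close> induces one of the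
  corresponding monoids. Let \<open>F\<close> be a partial free resolution over \<open>B\<close>. A partial free resolution \<open>P\<close> over
  \<open>C\<close> is built degree by degree, together with chain maps \<open>\<alpha> : F \<rightarrow> P\<close> (semilinear along \<open>psi\<close>) and
  \<open>\<beta> : P \<rightarrow> F\<close> (semilinear along \<open>phi\<close>). Since \<open>\<alpha> \<beta>\<close> is linear and lifts the identity, there is a
  homotopy \<open>h\<close> such that \<open>g = id - \<alpha> \<beta> - h d\<close> maps \<open>P\<^sub>k\<close> into the kernel \<open>Z\<close> of \<open>d\<close>.
  On \<open>Z\<close> this reads \<open>z = \<alpha> (\<beta> z) + g z\<close>, so \<open>Z = \<alpha> (d F\<^sub>k\<^sub>+\<^sub>1) + g (P\<^sub>k)\<close> is finitely generated, and
  \<open>P\<^sub>k\<^sub>+\<^sub>1\<close> can be taken free on the generators of \<open>F\<^sub>k\<^sub>+\<^sub>1\<close> and of \<open>P\<^sub>k\<close>; the inclusion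
  of the second summand is the next component of \<open>h\<close>.
\<close>

section \<open>Finitely supported functions\<close>

text \<open>Linear extension of \<open>h\<close> to finitely supported functions, scaled by
  \<open>k\<close>. Left, right and two-sided translation by a monomial are all of this form, so the
  laws below serve every action that occurs.\<close>

definition push :: "('x \<Rightarrow> 'y) \<Rightarrow> 'k::comm_ring_1 \<Rightarrow> ('x \<Rightarrow> 'k) \<Rightarrow> 'y \<Rightarrow> 'k" where
  "push h k f = (\<lambda>y. k * (\<Sum>x | f x \<noteq> 0 \<and> h x = y. f x))"

definition single :: "'x \<Rightarrow> 'k::zero \<Rightarrow> 'x \<Rightarrow> 'k" where
  "single x k = (\<lambda>y. if y = x then k else 0)"

lemma supp_fn_single: "supp_fn (single x k) \<subseteq> {x}"
  by (auto simp: supp_fn_def single_def)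

lemma finite_supp_single [simp]: "finite (supp_fn (single x k))"
  by (rule finite_subset[OF supp_fn_single]) simp

lemma supp_fn_zero [simp]: "supp_fn 0 = {}"
  by (simp add: supp_fn_def)

lemma finite_supp_add:
  fixes f g :: "'x \<Rightarrow> 'k::comm_ring_1"
  assumes "finite (supp_fn f)" "finite (supp_fn g)"
  shows "finite (supp_fn (f + g))"
  by (rule finite_subset[of _ "supp_fn f \<union> supp_fn g"]) (use assms in \<open>auto simp: supp_fn_def\<close>)

text \<open>Enlarging the index set to any finite \<open>A\<close> containing the support makes it
  independent of \<open>y\<close> and lets several functions be summed over one set.\<close>

lemma push_eq_sum:
  assumes "finite A" "supp_fn f \<subseteq> A"
  shows "push h k f y = (\<Sum>x\<in>A. if h x = y then k * f x else 0)"
proof -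
  have "(\<Sum>x | f x \<noteq> 0 \<and> h x = y. f x) = (\<Sum>x\<in>A. if h x = y then f x else 0)"
    by (rule sum.mono_neutral_cong_left) (use assms in \<open>auto simp: supp_fn_def\<close>)
  then show ?thesis
    unfolding push_def by (auto simp: sum_distrib_left intro!: sum.cong)
qed

lemma supp_fn_push:
  assumes "finite (supp_fn f)"
  shows "supp_fn (push h k f) \<subseteq> h ` supp_fn f"
proof
  fix y assume "y \<in> supp_fn (push h k f)"
  then have "(\<Sum>x\<in>supp_fn f. if h x = y then k * f x else 0) \<noteq> 0"
    unfolding push_eq_sum[OF assms order_refl, symmetric] by (simp add: supp_fn_def)
  then show "y \<in> h ` supp_fn f"
    by (rule contrapos_np) (auto intro!: sum.neutral)
qed

lemma finite_supp_push:
  "finite (supp_fn f) \<Longrightarrow> finite (supp_fn (push h k f))"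
  by (meson finite_surj supp_fn_push)

lemma push_add:
  assumes "finite (supp_fn f)" "finite (supp_fn g)"
  shows "push h k (f + g) = push h k f + push h k g"
proof
  fix y
  let ?A = "supp_fn f \<union> supp_fn g"
  have fin: "finite ?A" using assms by simp
  have sub: "supp_fn (f + g) \<subseteq> ?A" by (auto simp: supp_fn_def)
  show "push h k (f + g) y = (push h k f + push h k g) y"
    by (simp add: push_eq_sum[OF fin sub] push_eq_sum[OF fin Un_upper1]
        push_eq_sum[OF fin Un_upper2] flip: sum.distrib)
      (auto intro!: sum.cong simp: algebra_simps)
qed

lemma push_add_scalar: "push h (k + l) f = push h k f + push h l f"
  by (rule ext) (simp add: push_def algebra_simps)

lemma push_zero_right [simp]: "push h k 0 = 0"
  by (rule ext) (simp add: push_def)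

lemma push_push:
  assumes fin: "finite (supp_fn f)"
  shows "push h k (push h' l f) = push (h \<circ> h') (k * l) f"
proof
  fix z
  let ?A = "supp_fn f"
  have "push h k (push h' l f) z
      = (\<Sum>y\<in>h' ` ?A. if h y = z then k * (\<Sum>x\<in>?A. if h' x = y then l * f x else 0) else 0)"
    unfolding push_eq_sum[OF finite_imageI[OF fin] supp_fn_push[OF fin]]
      push_eq_sum[OF fin order_refl] ..
  \<comment> \<open>The inner condition is rewritten as \<open>y = h' x\<close>, so that after
    swapping the sums each \<open>x\<close> contributes at exactly one \<open>y\<close>.\<close>
  also have "\<dots> = (\<Sum>y\<in>h' ` ?A. \<Sum>x\<in>?A. if y = h' x then if h y = z then k * l * f x else 0 else 0)"
  proof (rule sum.cong)
    fix y
    have "k * (if h' x = y then l * f x else 0) = (if y = h' x then k * l * f x else 0)" for x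
      by (simp add: mult.assoc)
    then show "(if h y = z then k * (\<Sum>x\<in>?A. if h' x = y then l * f x else 0) else 0)
      = (\<Sum>x\<in>?A. if y = h' x then if h y = z then k * l * f x else 0 else 0)"
      by (auto simp: sum_distrib_left intro!: sum.cong sum.neutral)
  qed simp
  also have "\<dots> = (\<Sum>x\<in>?A. \<Sum>y\<in>h' ` ?A. if y = h' x then if h y = z then k * l * f x else 0 else 0)"
    by (rule sum.swap)
  also have "\<dots> = (\<Sum>x\<in>?A. if h (h' x) = z then k * l * f x else 0)"
    by (rule sum.cong) (use fin in \<open>auto simp: sum.delta\<close>)
  also have "\<dots> = push (h \<circ> h') (k * l) f z"
    using push_eq_sum[OF fin order_refl, of "h \<circ> h'"] by simp
  finally show "push h k (push h' l f) z = push (h \<circ> h') (k * l) f z" .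
qed

lemma push_id: "finite (supp_fn f) \<Longrightarrow> push (\<lambda>x. x) 1 f = f"
  by (rule ext) (auto simp: push_eq_sum supp_fn_def)

lemma push_single: "push h k (single x l) = single (h x) (k * l)"
proof
  fix y
  show "push h k (single x l) y = single (h x) (k * l) y"
    using push_eq_sum[OF _ supp_fn_single, of x h k l y] by (auto simp: single_def)
qed

lemma push_sum:
  assumes "finite I" "\<And>i. i \<in> I \<Longrightarrow> finite (supp_fn (f i))"
  shows "push h k (\<Sum>i\<in>I. f i) = (\<Sum>i\<in>I. push h k (f i)) \<and> finite (supp_fn (\<Sum>i\<in>I. f i))"
  using assms by (induction I rule: finite_induct) (auto simp: push_add finite_supp_add)

section \<open>Modules over a monoid algebra\<close>

text \<open>Scalars are the monomials \<open>k \<cdot> m\<close> only, encoded as pairs \<open>(k, m)\<close>; they generate the monoid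
  algebra additively, so additive maps commuting with them are the module homomorphisms. The
  multiplication is a parameter so that opposite monoids need no new type.\<close>

locale monoid_module = monoid mult one
  for mult :: "'m \<Rightarrow> 'm \<Rightarrow> 'm" and one :: 'm +
  fixes N :: "'n::ab_group_add set" and act :: "'k::comm_ring_1 \<times> 'm \<Rightarrow> 'n \<Rightarrow> 'n"
  assumes zero_mem: "0 \<in> N"
    and add_mem: "x \<in> N \<Longrightarrow> y \<in> N \<Longrightarrow> x + y \<in> N"
    and act_mem: "x \<in> N \<Longrightarrow> act s x \<in> N"
    and act_add: "x \<in> N \<Longrightarrow> y \<in> N \<Longrightarrow> act s (x + y) = act s x + act s y"
    and act_add_scalar: "x \<in> N \<Longrightarrow> act (k + l, m) x = act (k, m) x + act (l, m) x"
    and act_act: "x \<in> N \<Longrightarrow> act (k, m) (act (l, p) x) = act (k * l, mult m p) x"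
    and act_one: "x \<in> N \<Longrightarrow> act (1, one) x = x"
begin

lemma act_zero_scalar: "x \<in> N \<Longrightarrow> act (0, m) x = 0"
  using act_add_scalar[of x 0 0 m] by simp

lemma act_zero: "act s 0 = 0"
  using act_add[OF zero_mem zero_mem, of s] by simp

text \<open>Closure under negation is not an axiom of the locale; it follows because the monomial
  \<open>(- 1, one)\<close> acts as negation.\<close>

lemma uminus_mem: assumes "x \<in> N" shows "- x \<in> N"
proof -
  have "act (1, one) x + act (- 1, one) x = 0"
    using act_add_scalar[OF assms, of 1 "- 1" one] act_zero_scalar[OF assms] by simp
  then have "act (- 1, one) x = - x"
    using act_one[OF assms] by (simp add: eq_neg_iff_add_eq_0 add.commute)
  then show ?thesis using act_mem[OF assms] by metis
qed

lemma diff_mem: "x \<in> N \<Longrightarrow> y \<in> N \<Longrightarrow> x - y \<in> N"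
  using add_mem[OF _ uminus_mem, of x y] by simp

lemma act_diff:
  assumes "x \<in> N" "y \<in> N" shows "act s (x - y) = act s x - act s y"
  using act_add[OF diff_mem[OF assms] assms(2), of s] by (simp add: algebra_simps)

lemma sum_mem: "(\<And>i. i \<in> I \<Longrightarrow> f i \<in> N) \<Longrightarrow> sum f I \<in> N"
  by (induction I rule: infinite_finite_induct) (auto intro: zero_mem add_mem)

end

section \<open>Restriction of scalars and homomorphisms\<close>

definition restrict_scalars :: "('m \<Rightarrow> 'l) \<Rightarrow> ('k \<times> 'l \<Rightarrow> 'n \<Rightarrow> 'n) \<Rightarrow> 'k \<times> 'm \<Rightarrow> 'n \<Rightarrow> 'n" where
  "restrict_scalars h act = (\<lambda>(k, m). act (k, h m))"

lemma monoid_module_restrict_scalars: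
  assumes "monoid_module mult one N act" "monoid mult' one'"
    "h one' = one" "\<And>x y. h (mult' x y) = mult (h x) (h y)"
  shows "monoid_module mult' one' N (restrict_scalars h act)"
proof -
  interpret monoid_module mult one N act by fact
  interpret M': monoid mult' one' by fact
  show ?thesis
    by unfold_locales
      (auto simp: restrict_scalars_def assms(3,4) zero_mem add_mem act_mem act_add
        act_add_scalar act_act act_one)
qed

text \<open>A semilinear map along \<open>h\<close> is encoded as a homomorphism into a restricted
  module. Restricting the outer map as well makes \<open>is_hom_comp\<close> applicable to
  composites of semilinear maps.\<close>

lemma is_hom_restrict_scalars:
  "is_hom UNIV P actP M actM f
    \<Longrightarrow> is_hom UNIV P (restrict_scalars h actP) M (restrict_scalars h actM) f"
  by (auto simp: is_hom_def restrict_scalars_def)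

lemma restrict_scalars_comp:
  "restrict_scalars h (restrict_scalars h' act) = restrict_scalars (h' \<circ> h) act"
  by (auto simp: restrict_scalars_def)

lemma restrict_scalars_id: "(\<And>x. h x = x) \<Longrightarrow> restrict_scalars h act = act"
  by (auto simp: restrict_scalars_def)

lemma is_hom_comp:
  "is_hom S P actP M actM f \<Longrightarrow> is_hom S M actM N actN g
    \<Longrightarrow> is_hom S P actP N actN (\<lambda>x. g (f x))"
  by (auto simp: is_hom_def)

lemma is_hom_zero:
  assumes "is_hom S P actP M actM f" "0 \<in> P" shows "f 0 = 0"
proof -
  have "f (0 + 0) = f 0 + f 0" using assms unfolding is_hom_def by blast
  then show ?thesis by simp
qed

lemma is_hom_sub:
  assumes f: "is_hom UNIV P actP M actM f" and g: "is_hom UNIV P actP M actM g"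
    and M: "monoid_module mult one M actM"
  shows "is_hom UNIV P actP M actM (\<lambda>x. f x - g x)"
proof -
  interpret monoid_module mult one M actM by fact
  show ?thesis using f g unfolding is_hom_def by (auto simp: diff_mem act_diff)
qed

lemma is_hom_diff:
  assumes f: "is_hom UNIV P actP M actM f" and P: "monoid_module mult one P actP"
    and "x \<in> P" "y \<in> P"
  shows "f (x - y) = f x - f y"
proof -
  interpret monoid_module mult one P actP by fact
  have "f ((x - y) + y) = f (x - y) + f y"
    using f diff_mem assms(3,4) unfolding is_hom_def by blast
  then show ?thesis by simp
qed

lemma is_hom_sum:
  assumes f: "is_hom S P actP M actM f" and "0 \<in> P" "\<And>x y. x \<in> P \<Longrightarrow> y \<in> P \<Longrightarrow> x + y \<in> P"
    and "\<And>i. i \<in> I \<Longrightarrow> g i \<in> P"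
  shows "f (sum g I) = (\<Sum>i\<in>I. f (g i)) \<and> sum g I \<in> P"
  using assms(4)
proof (induction I rule: infinite_finite_induct)
  case (insert i I)
  then show ?case using f assms(3) unfolding is_hom_def by auto
qed (auto simp: is_hom_zero[OF f] assms(2))

text \<open>Syzygies have to be modules in their own right, since \<open>fmod_lift\<close> will be
  applied with a kernel as target.\<close>

lemma monoid_module_kernel:
  assumes P: "monoid_module mult one P actP" and M: "monoid_module mult one M actM"
    and f: "is_hom UNIV P actP M actM f"
  shows "monoid_module mult one {x \<in> P. f x = 0} actP"
proof -
  interpret P: monoid_module mult one P actP by fact
  interpret M: monoid_module mult one M actM by fact
  have "f (x + y) = f x + f y" "f (actP s x) = actM s (f x)" if "x \<in> P" "y \<in> P" for s x y
    using f that unfolding is_hom_def by blast+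
  then show ?thesis
    by unfold_locales
      (auto simp: P.zero_mem P.add_mem P.act_mem P.act_add P.act_add_scalar P.act_act P.act_one
        M.act_zero is_hom_zero[OF f])
qed

section \<open>Free modules of finite rank and their universal property\<close>

definition fmod :: "nat \<Rightarrow> (nat \<Rightarrow> 'm \<Rightarrow> 'k::comm_ring_1) set" where
  "fmod r = {v. (\<forall>i. finite (supp_fn (v i))) \<and> (\<forall>i. r \<le> i \<longrightarrow> v i = 0)}"

definition free_act :: "('m \<Rightarrow> 'm \<Rightarrow> 'm) \<Rightarrow> 'k::comm_ring_1 \<times> 'm \<Rightarrow> (nat \<Rightarrow> 'm \<Rightarrow> 'k) \<Rightarrow> nat \<Rightarrow> 'm \<Rightarrow> 'k" where
  "free_act mult s v = (\<lambda>i. push (mult (snd s)) (fst s) (v i))"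

lemma monoid_module_fmod:
  assumes "monoid mult one"
  shows "monoid_module mult one (fmod r) (free_act mult)"
proof -
  interpret monoid mult one by fact
  have assoc_fun: "mult m \<circ> mult p = mult (mult m p)" for m p
    by (auto simp: assoc)
  have unit_fun: "mult one = (\<lambda>x. x)" by auto
  \<comment> \<open>Extensionality is confined to the coordinate index, so that the
    \<open>push\<close> laws still match whole coordinate functions.\<close>
  show ?thesis
    by unfold_locales
      (auto simp: fmod_def free_act_def finite_supp_add finite_supp_push push_add
        push_add_scalar push_push assoc_fun unit_fun push_id fun_eq_iff[where ?'a = nat])
qed

text \<open>The monomial with coefficient \<open>k\<close> at \<open>x\<close> in coordinate
  \<open>i\<close>; the elements \<open>elt i one 1\<close> are the basis of the free
  module.\<close>

definition elt :: "nat \<Rightarrow> 'm \<Rightarrow> 'k::comm_ring_1 \<Rightarrow> nat \<Rightarrow> 'm \<Rightarrow> 'k" where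
  "elt i x k = (\<lambda>j. if j = i then single x k else 0)"

lemma elt_mem: "i < r \<Longrightarrow> elt i x k \<in> fmod r"
  by (auto simp: elt_def fmod_def)

lemma free_act_elt: "free_act mult (k, m) (elt i x l) = elt i (mult m x) (k * l)"
  by (rule ext) (simp add: free_act_def elt_def push_single)

lemma sum_fun_apply: "(\<Sum>i\<in>I. f i) x = (\<Sum>i\<in>I. f i x)"
  by (induction I rule: infinite_finite_induct) auto

lemma fmod_eq_sum:
  assumes "v \<in> fmod r"
  shows "v = (\<Sum>i<r. \<Sum>x\<in>supp_fn (v i). elt i x (v i x))"
proof (intro ext)
  fix j y
  have fin: "finite (supp_fn (v i))" for i using assms by (simp add: fmod_def)
  have "(\<Sum>i<r. \<Sum>x\<in>supp_fn (v i). elt i x (v i x)) j y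
      = (\<Sum>i<r. \<Sum>x\<in>supp_fn (v i). elt i x (v i x) j y)"
    by (simp add: sum_fun_apply)
  also have "\<dots> = (\<Sum>i<r. if i = j then v i y else 0)"
  proof (rule sum.cong)
    fix i
    have "(\<Sum>x\<in>supp_fn (v i). elt i x (v i x) j y)
        = (\<Sum>x\<in>supp_fn (v i). if x = y then (if i = j then v i x else 0) else 0)"
      by (rule sum.cong) (auto simp: elt_def single_def)
    also have "\<dots> = (if i = j then v i y else 0)"
      using fin[of i] by (auto simp: sum.delta supp_fn_def)
    finally show "(\<Sum>x\<in>supp_fn (v i). elt i x (v i x) j y) = (if i = j then v i y else 0)" .
  qed simp
  also have "\<dots> = v j y" using assms by (auto simp: fmod_def)
  finally show "v j y = (\<Sum>i<r. \<Sum>x\<in>supp_fn (v i). elt i x (v i x)) j y" by simp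
qed

text \<open>Every vector is a finite sum of monomials, so a property stable under sums has to be
  checked on monomials only.\<close>

lemma fmod_induct [consumes 1, case_names zero add elt]:
  assumes v: "v \<in> fmod r" and zero: "P 0"
    and add: "\<And>v w. v \<in> fmod r \<Longrightarrow> w \<in> fmod r \<Longrightarrow> P v \<Longrightarrow> P w \<Longrightarrow> P (v + w)"
    and elt: "\<And>i x k. i < r \<Longrightarrow> P (elt i x k)"
  shows "P v"
proof -
  have zero_mem: "0 \<in> fmod r" by (simp add: fmod_def)
  have add_mem: "v + w \<in> fmod r" if "v \<in> fmod r" "w \<in> fmod r" for v w :: "nat \<Rightarrow> 'a \<Rightarrow> 'b"
    using that by (auto simp: fmod_def finite_supp_add)
  have sum: "P (sum f I) \<and> sum f I \<in> fmod r" if "\<And>i. i \<in> I \<Longrightarrow> P (f i) \<and> f i \<in> fmod r"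
    for f and I :: "(nat \<times> 'a) set"
    using that by (induction I rule: infinite_finite_induct) (auto simp: zero zero_mem add add_mem)
  have fin: "finite (supp_fn (v i))" for i using v by (simp add: fmod_def)
  \<comment> \<open>Flattening the double sum over coordinates and supports to one sum over pairs
    leaves a single finite sum, to which \<open>sum\<close> applies.\<close>
  have "P (\<Sum>(i, x)\<in>(SIGMA i:{..<r}. supp_fn (v i)). elt i x (v i x))"
    by (rule sum[THEN conjunct1]) (auto simp: elt elt_mem)
  moreover have "(\<Sum>(i, x)\<in>(SIGMA i:{..<r}. supp_fn (v i)). elt i x (v i x)) = v"
    by (rule trans[OF sum.Sigma[symmetric] fmod_eq_sum[OF v, symmetric]]) (auto simp: fin)
  ultimately show ?thesis by (simp only:)
qed

text \<open>Existence half of freeness: a homomorphism with prescribed values on the basis is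
  written down explicitly.\<close>

lemma fmod_lift:
  assumes N: "monoid_module mult one N act" and n: "\<And>i. i < r \<Longrightarrow> n i \<in> N"
  obtains f where "is_hom UNIV (fmod r) (free_act mult) N act f" "\<And>i. i < r \<Longrightarrow> f (elt i one 1) = n i"
proof -
  interpret monoid_module mult one N act by fact
  interpret F: monoid_module mult one "fmod r" "free_act mult :: 'c \<times> 'a \<Rightarrow> _"
    by (rule monoid_module_fmod) unfold_locales
  \<comment> \<open>Linearity forces this formula, because \<open>v\<close> is the sum of the
    monomials \<open>v i x\<close> times \<open>x\<close> applied to the basis elements.\<close>
  define f where "f v = (\<Sum>i<r. \<Sum>x\<in>supp_fn (v i). act (v i x, x) (n i))" for v
  have f_mem: "f v \<in> N" for v
    unfolding f_def by (intro sum_mem) (auto intro!: act_mem n)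
  \<comment> \<open>The supports of \<open>v\<close>, \<open>w\<close> and \<open>v + w\<close>
    differ; since the scalar 0 acts as zero, all three sums can be taken over one common finite
    set.\<close>
  have superset: "(\<Sum>x\<in>supp_fn u. act (u x, x) (n i)) = (\<Sum>x\<in>A. act (u x, x) (n i))"
    if "finite A" "supp_fn u \<subseteq> A" "i < r" for u A i
    by (rule sum.mono_neutral_left) (use that in \<open>auto simp: supp_fn_def act_zero_scalar n\<close>)
  have f_add: "f (v + w) = f v + f w" if "v \<in> fmod r" "w \<in> fmod r" for v w
  proof -
    have "(\<Sum>x\<in>supp_fn ((v + w) i). act ((v + w) i x, x) (n i))
      = (\<Sum>x\<in>supp_fn (v i). act (v i x, x) (n i)) + (\<Sum>x\<in>supp_fn (w i). act (w i x, x) (n i))"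
      if "i < r" for i
    proof -
      let ?A = "supp_fn (v i) \<union> supp_fn (w i)"
      have fin: "finite ?A" using \<open>v \<in> fmod r\<close> \<open>w \<in> fmod r\<close> by (simp add: fmod_def)
      have sub: "supp_fn ((v + w) i) \<subseteq> ?A" by (auto simp: supp_fn_def)
      show ?thesis
        unfolding superset[OF fin sub that] superset[OF fin Un_upper1 that]
          superset[OF fin Un_upper2 that]
        using n[OF that] by (simp add: act_add_scalar flip: sum.distrib)
    qed
    then show ?thesis unfolding f_def by (simp flip: sum.distrib)
  qed
  have f_elt: "f (elt i x k) = act (k, x) (n i)" if "i < r" for i x k
  proof -
    have "f (elt i x k)
        = (\<Sum>j<r. if j = i then \<Sum>y\<in>supp_fn (single x k). act (single x k y, y) (n i) else 0)"
      unfolding f_def by (rule sum.cong) (auto simp: elt_def)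
    also have "\<dots> = (\<Sum>y\<in>supp_fn (single x k). act (single x k y, y) (n i))"
      using that by simp
    also have "\<dots> = (\<Sum>y\<in>{x}. act (single x k y, y) (n i))"
      by (rule superset) (auto simp: supp_fn_single that)
    finally show ?thesis by (simp add: single_def)
  qed
  \<comment> \<open>Both sides are additive in \<open>v\<close>, which leaves the case of monomials,
    where \<open>act_act\<close> applies.\<close>
  have f_act: "f (free_act mult s v) = act s (f v)" if "v \<in> fmod r" for s v
    using that
  proof (induction v rule: fmod_induct)
    case zero
    have "f 0 = 0" unfolding f_def by simp
    then show ?case using F.act_zero act_zero by metis
  next
    case (add v w)
    have "f (free_act mult s (v + w)) = f (free_act mult s v + free_act mult s w)"
      using F.act_add[OF add(1,2)] by metis
    also have "\<dots> = act s (f v) + act s (f w)"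
      using f_add[OF F.act_mem[OF add(1)] F.act_mem[OF add(2)]] add(3,4) by metis
    also have "\<dots> = act s (f (v + w))"
      using act_add[OF f_mem f_mem] f_add[OF add(1,2)] by metis
    finally show ?case .
  next
    case (elt i x k)
    obtain l m where "s = (l, m)" by fastforce
    then show ?case by (simp only: free_act_elt f_elt[OF elt] act_act[OF n[OF elt]])
  qed
  have "is_hom UNIV (fmod r) (free_act mult) N act f"
    unfolding is_hom_def using f_mem f_add f_act by blast
  moreover have "f (elt i one 1) = n i" if "i < r" for i
    using f_elt[OF that] act_one[OF n[OF that]] by metis
  ultimately show thesis by (rule that)
qed

text \<open>Uniqueness half of freeness: a monomial is a scalar applied to a basis element. It
  reduces the chain map identities to the basis.\<close>

lemma fmod_hom_unique:
  assumes "monoid mult one"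
    and f: "is_hom UNIV (fmod r) (free_act mult) N act f"
    and g: "is_hom UNIV (fmod r) (free_act mult) N' act g"
    and basis: "\<And>i. i < r \<Longrightarrow> f (elt i one 1) = g (elt i one 1)"
    and v: "v \<in> fmod r"
  shows "f v = g v"
proof -
  interpret monoid mult one by fact
  have zero: "0 \<in> (fmod r :: (nat \<Rightarrow> 'a \<Rightarrow> 'b) set)" by (simp add: fmod_def)
  show ?thesis using v
  proof (induction v rule: fmod_induct)
    case zero
    show ?case using is_hom_zero[OF f \<open>0 \<in> fmod r\<close>] is_hom_zero[OF g \<open>0 \<in> fmod r\<close>] by metis
  next
    case (add v w)
    have "f (v + w) = f v + f w" using f add(1,2) unfolding is_hom_def by blast
    moreover have "g (v + w) = g v + g w" using g add(1,2) unfolding is_hom_def by blast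
    ultimately show ?case using add(3,4) by metis
  next
    case (elt i x k)
    have eq: "elt i x k = free_act mult (k, x) (elt i one 1)"
      by (simp only: free_act_elt right_neutral mult_1_right)
    have "f (elt i x k) = act (k, x) (f (elt i one 1))"
      unfolding eq using f elt_mem[OF elt, of one 1] unfolding is_hom_def by blast
    moreover have "g (elt i x k) = act (k, x) (g (elt i one 1))"
      unfolding eq using g elt_mem[OF elt, of one 1] unfolding is_hom_def by blast
    ultimately show ?case using basis[OF elt] by metis
  qed
qed

lemma is_hom_mono:
  "is_hom S P actP Z actM f \<Longrightarrow> Z \<subseteq> M \<Longrightarrow> is_hom S P actP M actM f"
  by (auto simp: is_hom_def)

section \<open>Descent of resolutions along a retraction\<close>

text \<open>The case distinction absorbs the separate name \<open>d0\<close> of the augmentation, so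
  that exactness reads alike in every degree.\<close>

definition syzygy :: "(nat \<Rightarrow> 'p::ab_group_add set) \<Rightarrow> (nat \<Rightarrow> nat) \<Rightarrow> ('p \<Rightarrow> 'n::ab_group_add)
    \<Rightarrow> (nat \<Rightarrow> 'p \<Rightarrow> 'p) \<Rightarrow> nat \<Rightarrow> 'p set" where
  "syzygy F r d0 d i = {x \<in> F (r i). if i = 0 then d0 x = 0 else d i x = 0}"

definition is_resolution :: "nat \<Rightarrow> 's set \<Rightarrow> (nat \<Rightarrow> 'p::ab_group_add set)
    \<Rightarrow> ('s \<Rightarrow> 'p \<Rightarrow> 'p) \<Rightarrow> 'n::ab_group_add set \<Rightarrow> ('s \<Rightarrow> 'n \<Rightarrow> 'n)
    \<Rightarrow> (nat \<Rightarrow> nat) \<Rightarrow> ('p \<Rightarrow> 'n) \<Rightarrow> (nat \<Rightarrow> 'p \<Rightarrow> 'p) \<Rightarrow> bool" where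
  "is_resolution n S F actF M actM r d0 d \<longleftrightarrow>
     is_hom S (F (r 0)) actF M actM d0 \<and> d0 ` F (r 0) = M \<and>
     (\<forall>i<n. is_hom S (F (r (Suc i))) actF (F (r i)) actF (d (Suc i)) \<and>
       d (Suc i) ` F (r (Suc i)) = syzygy F r d0 d i)"

text \<open>Shifting the index by one merges exactness at degree 0 with the higher degrees, which
  suits a construction degree by degree.\<close>

lemma has_FPn_resolution_iff:
  "has_FPn_resolution n S F actF M actM \<longleftrightarrow> (\<exists>r d0 d. is_resolution n S F actF M actM r d0 d)"
proof -
  have hom: "(\<forall>i. 1 \<le> i \<and> i \<le> n \<longrightarrow> P i (i - 1)) \<longleftrightarrow> (\<forall>i<n. P (Suc i) i)" for P :: "nat \<Rightarrow> nat \<Rightarrow> bool"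
  proof (intro iffI allI impI)
    fix i assume "\<forall>i. 1 \<le> i \<and> i \<le> n \<longrightarrow> P i (i - 1)" "i < n"
    from this(1)[rule_format, of "Suc i"] this(2) show "P (Suc i) i" by simp
  next
    fix i assume "\<forall>i<n. P (Suc i) i" "1 \<le> i \<and> i \<le> n"
    then obtain j where "i = Suc j" by (cases i) auto
    with \<open>\<forall>i<n. P (Suc i) i\<close> \<open>1 \<le> i \<and> i \<le> n\<close> show "P i (i - 1)" by simp
  qed
  have img: "(\<forall>i<n. d (Suc i) ` F (r (Suc i)) = syzygy F r d0 d i) \<longleftrightarrow>
      (1 \<le> n \<longrightarrow> d 1 ` F (r 1) = {x \<in> F (r 0). d0 x = 0}) \<and>
      (\<forall>i. 1 \<le> i \<and> i < n \<longrightarrow> d (i + 1) ` F (r (i + 1)) = {x \<in> F (r i). d i x = 0})" for r d0 d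
  proof -
    have "(\<forall>i<n. Q i) \<longleftrightarrow> (1 \<le> n \<longrightarrow> Q 0) \<and> (\<forall>i. 1 \<le> i \<and> i < n \<longrightarrow> Q i)" for Q
      by (metis One_nat_def Suc_le_eq gr0I)
    from this[of "\<lambda>i. d (Suc i) ` F (r (Suc i)) = syzygy F r d0 d i"] show ?thesis
      by (simp add: syzygy_def)
  qed
  have "is_resolution n S F actF M actM r d0 d \<longleftrightarrow>
      is_hom S (F (r 0)) actF M actM d0 \<and> d0 ` F (r 0) = M \<and>
      (\<forall>i. 1 \<le> i \<and> i \<le> n \<longrightarrow> is_hom S (F (r i)) actF (F (r (i - 1))) actF (d i)) \<and>
      (1 \<le> n \<longrightarrow> d 1 ` F (r 1) = {x \<in> F (r 0). d0 x = 0}) \<and>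
      (\<forall>i. 1 \<le> i \<and> i < n \<longrightarrow> d (i + 1) ` F (r (i + 1)) = {x \<in> F (r i). d i x = 0})" for r d0 d
    unfolding is_resolution_def img[symmetric]
      hom[of "\<lambda>i j. is_hom S (F (r i)) actF (F (r j)) actF (d i)"] by blast
  then show ?thesis unfolding has_FPn_resolution_def by simp
qed

locale retract_pair =
  B: monoid multB oneB + C: monoid multC oneC
  for multB :: "'m \<Rightarrow> 'm \<Rightarrow> 'm" and oneB and multC :: "'l \<Rightarrow> 'l \<Rightarrow> 'l" and oneC +
  fixes psi :: "'m \<Rightarrow> 'l" and phi :: "'l \<Rightarrow> 'm"
  assumes psi_one: "psi oneB = oneC" and psi_mult: "psi (multB x y) = multC (psi x) (psi y)"
    and phi_one: "phi oneC = oneB" and phi_mult: "phi (multC u v) = multB (phi u) (phi v)"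
    and psi_phi: "psi (phi u) = u"
begin

text \<open>The invariant carried from one degree to the next, with the current syzygies as
  \<open>W\<close> and \<open>Z\<close>. The map \<open>g\<close> measures how far
  \<open>\<alpha> \<beta>\<close> is from the identity on \<open>Z\<close>; being defined on the
  whole free module with values in \<open>Z\<close>, it has a finitely generated image.\<close>

definition comparison :: "nat \<Rightarrow> (nat \<Rightarrow> 'm \<Rightarrow> 'k::comm_ring_1) set \<Rightarrow> nat \<Rightarrow> (nat \<Rightarrow> 'l \<Rightarrow> 'k) set \<Rightarrow> bool" where
  "comparison r W s Z \<longleftrightarrow> (\<exists>\<alpha> \<beta> g.
    is_hom UNIV (fmod r) (free_act multB) (fmod s) (restrict_scalars psi (free_act multC)) \<alpha> \<and>
    is_hom UNIV (fmod s) (free_act multC) (fmod r) (restrict_scalars phi (free_act multB)) \<beta> \<and>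
    \<alpha> ` W \<subseteq> Z \<and> \<beta> ` Z \<subseteq> W \<and>
    is_hom UNIV (fmod s) (free_act multC) Z (free_act multC) g \<and> (\<forall>v\<in>Z. \<alpha> (\<beta> v) + g v = v))"

text \<open>In degree \<open>-1\<close> one takes \<open>t = 0\<close> and \<open>Z = X\<close>; afterwards \<open>X\<close> is free of rank \<open>t\<close> with kernel \<open>Z\<close>
  and \<open>j\<close> is the identity. Allowing any \<open>G \<circ> j\<close> treats both cases at once.\<close>

lemma resolution_step:
  fixes actX :: "'k::comm_ring_1 \<times> 'l \<Rightarrow> 'x::ab_group_add \<Rightarrow> 'x"
    and actY :: "'k \<times> 'm \<Rightarrow> 'y::ab_group_add \<Rightarrow> 'y"
  assumes X: "monoid_module multC oneC X actX" and Z: "monoid_module multC oneC Z actX"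
    and ZX: "Z \<subseteq> X"
    and Y: "monoid_module multB oneB Y actY"
    and \<alpha>: "is_hom UNIV Y actY X (restrict_scalars psi actX) \<alpha>"
    and \<beta>: "is_hom UNIV X actX Y (restrict_scalars phi actY) \<beta>"
    and \<alpha>W: "\<alpha> ` W \<subseteq> Z" and \<beta>Z: "\<beta> ` Z \<subseteq> W"
    and d: "is_hom UNIV (fmod r) (free_act multB) Y actY d" and d_img: "d ` fmod r = W"
    and G: "is_hom UNIV (fmod t) (free_act multC) Z actX G"
    and j: "is_hom UNIV X actX (fmod t) (free_act multC) j"
    and split: "\<And>z. z \<in> Z \<Longrightarrow> \<alpha> (\<beta> z) + G (j z) = z"
  obtains s d' where
    "is_hom UNIV (fmod s) (free_act multC) X actX d'" "d' ` fmod s = Z"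
    "comparison r {y \<in> fmod r. d y = 0} s {v \<in> fmod s. d' v = 0}"
proof -
  interpret X: monoid_module multC oneC X actX by fact
  interpret Z: monoid_module multC oneC Z actX by fact
  interpret Y: monoid_module multB oneB Y actY by fact
  \<comment> \<open>The first \<open>r\<close> basis elements will map to the
    \<open>\<alpha>\<close>-images of the generators of \<open>W\<close>, the last \<open>t\<close>
    to the \<open>G\<close>-images of a basis.\<close>
  define s where "s = r + t"
  have Fr: "monoid_module multB oneB (fmod r) (free_act multB :: 'k \<times> 'm \<Rightarrow> _)"
    by (rule monoid_module_fmod) (rule B.monoid_axioms)
  have Fs: "monoid_module multC oneC (fmod s) (free_act multC :: 'k \<times> 'l \<Rightarrow> _)" for s
    by (rule monoid_module_fmod) (rule C.monoid_axioms)
  interpret Fs: monoid_module multC oneC "fmod s" "free_act multC :: 'k \<times> 'l \<Rightarrow> _" by (rule Fs)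
  have res_psi: "monoid_module multB oneB N (restrict_scalars psi act)"
    if "monoid_module multC oneC N act" for N :: "'z::ab_group_add set" and act :: "'k \<times> 'l \<Rightarrow> 'z \<Rightarrow> 'z"
    using monoid_module_restrict_scalars[OF that B.monoid_axioms, of psi] psi_one psi_mult by blast
  have res_phi: "monoid_module multC oneC N (restrict_scalars phi act)"
    if "monoid_module multB oneB N act" for N :: "'z::ab_group_add set" and act :: "'k \<times> 'm \<Rightarrow> 'z \<Rightarrow> 'z"
    using monoid_module_restrict_scalars[OF that C.monoid_axioms, of phi] phi_one phi_mult by blast
  let ?e = "\<lambda>i. elt i oneB (1::'k)" and ?e' = "\<lambda>i. elt i oneC (1::'k)"
  have n_mem: "(if i < r then \<alpha> (d (?e i)) else G (?e' (i - r))) \<in> Z" if "i < s" for i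
  proof (cases "i < r")
    case True
    have "d (?e i) \<in> W" unfolding d_img[symmetric] by (rule imageI[OF elt_mem[OF True]])
    then show ?thesis using True \<alpha>W by auto
  next
    case False
    then have "i - r < t" using that by (simp add: s_def)
    then have "G (?e' (i - r)) \<in> Z"
      using G elt_mem[of "i - r" t oneC "1::'k"] unfolding is_hom_def by blast
    then show ?thesis using False by simp
  qed
  obtain d' where d'Z: "is_hom UNIV (fmod s) (free_act multC) Z actX d'"
    and d'_e: "\<And>i. i < s \<Longrightarrow> d' (?e' i) = (if i < r then \<alpha> (d (?e i)) else G (?e' (i - r)))"
    using fmod_lift[OF Z, of s "\<lambda>i. if i < r then \<alpha> (d (?e i)) else G (?e' (i - r))", OF n_mem] by blast
  have d'X: "is_hom UNIV (fmod s) (free_act multC) X actX d'" by (rule is_hom_mono[OF d'Z ZX])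
  have d'_mem: "d' v \<in> Z" if "v \<in> fmod s" for v using d'Z that unfolding is_hom_def by blast
  \<comment> \<open>\<open>\<alpha>'\<close> hits the first \<open>r\<close> basis elements, and
    \<open>\<iota>\<close> below is the inclusion of the remaining \<open>t\<close>.\<close>
  obtain \<alpha>' where \<alpha>': "is_hom UNIV (fmod r) (free_act multB) (fmod s) (restrict_scalars psi (free_act multC)) \<alpha>'"
    and \<alpha>'_e: "\<And>i. i < r \<Longrightarrow> \<alpha>' (?e i) = ?e' i"
    using fmod_lift[OF res_psi[OF Fs[of s]], of r ?e'] elt_mem[of _ s oneC "1::'k"]
    by (metis s_def trans_less_add1)
  obtain \<iota> where \<iota>: "is_hom UNIV (fmod t) (free_act multC) (fmod s) (free_act multC) \<iota>"
    and \<iota>_e: "\<And>i. i < t \<Longrightarrow> \<iota> (?e' i) = ?e' (r + i)"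
    using fmod_lift[OF Fs[of s], of t "\<lambda>i. ?e' (r + i)"] elt_mem[of _ s oneC "1::'k"]
    by (metis s_def nat_add_left_cancel_less)
  \<comment> \<open>\<open>\<beta>\<close> is lifted over \<open>d\<close> on the basis:
    \<open>d'\<close> takes values in \<open>Z\<close>, and \<open>\<beta>\<close> maps
    \<open>Z\<close> into \<open>W\<close>, the image of \<open>d\<close>.\<close>
  have "\<exists>y. y \<in> fmod r \<and> d y = \<beta> (d' (?e' i))" if "i < s" for i
  proof -
    have "\<beta> (d' (?e' i)) \<in> W" using d'_mem[OF elt_mem[OF that]] \<beta>Z by blast
    then show ?thesis using d_img by (metis imageE)
  qed
  then obtain b where b_mem: "\<And>i. i < s \<Longrightarrow> b i \<in> fmod r"
    and d_b: "\<And>i. i < s \<Longrightarrow> d (b i) = \<beta> (d' (?e' i))" by metis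
  obtain \<beta>' where \<beta>': "is_hom UNIV (fmod s) (free_act multC) (fmod r) (restrict_scalars phi (free_act multB)) \<beta>'"
    and \<beta>'_e: "\<And>i. i < s \<Longrightarrow> \<beta>' (?e' i) = b i"
    using fmod_lift[OF res_phi[OF Fr], of s b, OF b_mem] by blast
  have \<alpha>_chain: "d' (\<alpha>' y) = \<alpha> (d y)" if "y \<in> fmod r" for y
  proof (rule fmod_hom_unique[OF B.monoid_axioms _ _ _ that])
    show "is_hom UNIV (fmod r) (free_act multB) X (restrict_scalars psi actX) (\<lambda>y. d' (\<alpha>' y))"
      by (rule is_hom_comp[OF \<alpha>' is_hom_restrict_scalars[OF d'X]])
    show "is_hom UNIV (fmod r) (free_act multB) X (restrict_scalars psi actX) (\<lambda>y. \<alpha> (d y))"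
      by (rule is_hom_comp[OF d \<alpha>])
    show "d' (\<alpha>' (?e i)) = \<alpha> (d (?e i))" if "i < r" for i
      using that d'_e[of i] \<alpha>'_e by (simp add: s_def)
  qed
  have \<beta>_chain: "d (\<beta>' v) = \<beta> (d' v)" if "v \<in> fmod s" for v
  proof (rule fmod_hom_unique[OF C.monoid_axioms _ _ _ that])
    show "is_hom UNIV (fmod s) (free_act multC) Y (restrict_scalars phi actY) (\<lambda>v. d (\<beta>' v))"
      by (rule is_hom_comp[OF \<beta>' is_hom_restrict_scalars[OF d]])
    show "is_hom UNIV (fmod s) (free_act multC) Y (restrict_scalars phi actY) (\<lambda>v. \<beta> (d' v))"
      by (rule is_hom_comp[OF d'X \<beta>])
    show "d (\<beta>' (?e' i)) = \<beta> (d' (?e' i))" if "i < s" for i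
      using that d_b \<beta>'_e by simp
  qed
  have d'_\<iota>: "d' (\<iota> u) = G u" if "u \<in> fmod t" for u
  proof (rule fmod_hom_unique[OF C.monoid_axioms _ _ _ that])
    show "is_hom UNIV (fmod t) (free_act multC) Z actX (\<lambda>u. d' (\<iota> u))"
      by (rule is_hom_comp[OF \<iota> d'Z])
    show "is_hom UNIV (fmod t) (free_act multC) Z actX G" by (rule G)
    show "d' (\<iota> (?e' i)) = G (?e' i)" if "i < t" for i
      using that d'_e[of "r + i"] \<iota>_e by (simp add: s_def)
  qed
  \<comment> \<open>The next component of the homotopy: it enters the new free module through the
    second summand.\<close>
  define h where "h x = \<iota> (j x)" for x
  have h: "is_hom UNIV X actX (fmod s) (free_act multC) h"
    unfolding h_def by (rule is_hom_comp[OF j \<iota>])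
  have d'_h: "d' (h x) = G (j x)" if "x \<in> X" for x
    using d'_\<iota> j that unfolding h_def is_hom_def by blast
  \<comment> \<open>The defect of the homotopy relation, which becomes the map \<open>g\<close> of
    the next comparison.\<close>
  define g where "g v = v - \<alpha>' (\<beta>' v) - h (d' v)" for v
  \<comment> \<open>Each factor is only semilinear, but \<open>psi\<close> after \<open>phi\<close>
    is the identity, so the composite is linear.\<close>
  have \<alpha>\<beta>: "is_hom UNIV (fmod s) (free_act multC) (fmod s) (free_act multC) (\<lambda>v. \<alpha>' (\<beta>' v))"
  proof -
    have "is_hom UNIV (fmod s) (free_act multC) (fmod s)
      (restrict_scalars phi (restrict_scalars psi (free_act multC))) (\<lambda>v. \<alpha>' (\<beta>' v))"
      by (rule is_hom_comp[OF \<beta>' is_hom_restrict_scalars[OF \<alpha>']])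
    then show ?thesis by (simp add: restrict_scalars_comp restrict_scalars_id psi_phi)
  qed
  have hd: "is_hom UNIV (fmod s) (free_act multC) (fmod s) (free_act multC) (\<lambda>v. h (d' v))"
    by (rule is_hom_comp[OF d'X h])
  have "is_hom UNIV (fmod s) (free_act multC) (fmod s) (free_act multC) (\<lambda>v::nat \<Rightarrow> 'l \<Rightarrow> 'k. v)"
    by (simp add: is_hom_def)
  then have g_hom: "is_hom UNIV (fmod s) (free_act multC) (fmod s) (free_act multC) g"
    unfolding g_def by (intro is_hom_sub[OF _ hd Fs] is_hom_sub[OF _ \<alpha>\<beta> Fs])
  have \<alpha>\<beta>_mem: "\<alpha>' (\<beta>' v) \<in> fmod s" and hd_mem: "h (d' v) \<in> fmod s" and \<beta>'_mem: "\<beta>' v \<in> fmod r"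
    if "v \<in> fmod s" for v
    using \<alpha>\<beta> hd \<beta>' that unfolding is_hom_def by blast+
  \<comment> \<open>By the chain map identities, \<open>split\<close> at the element
    \<open>d' v\<close> of \<open>Z\<close> cancels all terms.\<close>
  have d'_g: "d' (g v) = 0" if v: "v \<in> fmod s" for v
  proof -
    have "d' (g v) = d' v - d' (\<alpha>' (\<beta>' v)) - d' (h (d' v))"
      unfolding g_def
      using is_hom_diff[OF d'X Fs] Fs.diff_mem v \<alpha>\<beta>_mem[OF v] hd_mem[OF v] by metis
    also have "d' (\<alpha>' (\<beta>' v)) = \<alpha> (\<beta> (d' v))"
      using \<alpha>_chain[OF \<beta>'_mem[OF v]] \<beta>_chain[OF v] by metis
    also have "d' (h (d' v)) = G (j (d' v))"
      using d'_h d'_mem[OF v] ZX by blast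
    finally show ?thesis using split[OF d'_mem[OF v]] by (metis add_diff_cancel_left' diff_self)
  qed
  have d'_img: "d' ` fmod s = Z"
  proof
    show "d' ` fmod s \<subseteq> Z" using d'_mem by blast
    \<comment> \<open>For \<open>z\<close> in \<open>Z\<close> choose \<open>y\<close> with
      \<open>d y = \<beta> z\<close>; then \<open>\<alpha>' y + h z\<close> is a preimage, again by
      \<open>split\<close>.\<close>
    show "Z \<subseteq> d' ` fmod s"
    proof
      fix z assume z: "z \<in> Z"
      then obtain y where y: "y \<in> fmod r" "\<beta> z = d y" using \<beta>Z d_img by blast
      have \<alpha>'y: "\<alpha>' y \<in> fmod s" using \<alpha>' y(1) unfolding is_hom_def by blast
      have hz: "h z \<in> fmod s" using h z ZX unfolding is_hom_def by blast
      have "d' (\<alpha>' y + h z) = d' (\<alpha>' y) + d' (h z)"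
        using d'X \<alpha>'y hz unfolding is_hom_def by blast
      also have "\<dots> = \<alpha> (\<beta> z) + G (j z)"
        using \<alpha>_chain[OF y(1)] y(2) d'_h z ZX by (metis subsetD)
      also have "\<dots> = z" by (rule split[OF z])
      finally show "z \<in> d' ` fmod s" using Fs.add_mem[OF \<alpha>'y hz] by (metis imageI)
    qed
  qed
  have "comparison r {y \<in> fmod r. d y = 0} s {v \<in> fmod s. d' v = 0}"
    unfolding comparison_def
  proof (intro exI conjI ballI)
    show "\<alpha>' ` {y \<in> fmod r. d y = 0} \<subseteq> {v \<in> fmod s. d' v = 0}"
      using \<alpha>' \<alpha>_chain is_hom_zero[OF \<alpha> Y.zero_mem] unfolding is_hom_def by auto
    show "\<beta>' ` {v \<in> fmod s. d' v = 0} \<subseteq> {y \<in> fmod r. d y = 0}"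
      using \<beta>'_mem \<beta>_chain is_hom_zero[OF \<beta> X.zero_mem] by auto
    show "is_hom UNIV (fmod s) (free_act multC) {v \<in> fmod s. d' v = 0} (free_act multC) g"
      using g_hom d'_g unfolding is_hom_def by blast
    \<comment> \<open>On the kernel of \<open>d'\<close> the homotopy term vanishes, leaving the
      identity needed as \<open>split\<close> in the next degree.\<close>
    fix v assume "v \<in> {v \<in> fmod s. d' v = 0}"
    then have "h (d' v) = 0" using is_hom_zero[OF h X.zero_mem] by simp
    then have "g v = v - \<alpha>' (\<beta>' v)" unfolding g_def by (simp only: diff_zero)
    then show "\<alpha>' (\<beta>' v) + g v = v" by (metis add.commute diff_add_cancel)
  qed (fact \<alpha>' \<beta>')+
  then show thesis by (rule that[OF d'X d'_img])
qed

text \<open>Iterates \<open>resolution_step\<close>: each degree yields both a new free module and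
  the comparison of syzygies that starts the next one.\<close>

lemma has_FPn_resolution_transfer:
  fixes actX :: "'k::comm_ring_1 \<times> 'l \<Rightarrow> 'x::ab_group_add \<Rightarrow> 'x"
    and actY :: "'k \<times> 'm \<Rightarrow> 'y::ab_group_add \<Rightarrow> 'y"
  assumes X: "monoid_module multC oneC X actX" and Y: "monoid_module multB oneB Y actY"
    and \<alpha>: "is_hom UNIV Y actY X (restrict_scalars psi actX) \<alpha>"
    and \<beta>: "is_hom UNIV X actX Y (restrict_scalars phi actY) \<beta>"
    and \<alpha>\<beta>: "\<And>x. x \<in> X \<Longrightarrow> \<alpha> (\<beta> x) = x"
    and res: "has_FPn_resolution n UNIV fmod (free_act multB) Y actY"
  shows "has_FPn_resolution n UNIV fmod (free_act multC) X actX"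
proof -
  obtain r d0 d where res: "is_resolution n UNIV fmod (free_act multB) Y actY r d0 d"
    using res unfolding has_FPn_resolution_iff by blast
  have FB: "monoid_module multB oneB (fmod s) (free_act multB :: 'k \<times> 'm \<Rightarrow> _)" for s
    by (rule monoid_module_fmod) (rule B.monoid_axioms)
  have FC: "monoid_module multC oneC (fmod s) (free_act multC :: 'k \<times> 'l \<Rightarrow> _)" for s
    by (rule monoid_module_fmod) (rule C.monoid_axioms)
  interpret X: monoid_module multC oneC X actX by fact
  have "k \<le> n \<Longrightarrow> \<exists>s d0' d'. is_resolution k UNIV fmod (free_act multC) X actX s d0' d' \<and>
      comparison (r k) (syzygy fmod r d0 d k) (s k) (syzygy fmod s d0' d' k)" for k
  proof (induction k)
    case 0
    have d0: "is_hom UNIV (fmod (r 0)) (free_act multB) Y actY d0" "d0 ` fmod (r 0) = Y"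
      using res by (simp_all add: is_resolution_def)
    have \<alpha>Y: "\<alpha> ` Y \<subseteq> X" and \<beta>X: "\<beta> ` X \<subseteq> Y" using \<alpha> \<beta> by (auto simp: is_hom_def)
    \<comment> \<open>At the start \<open>\<alpha> \<beta>\<close> is already the identity on
      \<open>X\<close>, so no generators are added: \<open>t\<close> is 0 and both \<open>G\<close>
      and \<open>j\<close> vanish.\<close>
    have G: "is_hom UNIV (fmod 0) (free_act multC) X actX (\<lambda>_::nat \<Rightarrow> 'l \<Rightarrow> 'k. 0)"
      by (simp add: is_hom_def X.zero_mem X.act_zero)
    interpret F: monoid_module multC oneC "fmod 0" "free_act multC :: 'k \<times> 'l \<Rightarrow> _" by (rule FC)
    have j: "is_hom UNIV X actX (fmod 0) (free_act multC) (\<lambda>_. 0 :: nat \<Rightarrow> 'l \<Rightarrow> 'k)"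
      unfolding is_hom_def by (simp only: F.zero_mem F.act_zero add_0) simp
    have split: "\<alpha> (\<beta> z) + 0 = z" if "z \<in> X" for z using \<alpha>\<beta>[OF that] by simp
    obtain s0 d0' where "is_hom UNIV (fmod s0) (free_act multC) X actX d0'" "d0' ` fmod s0 = X"
      "comparison (r 0) {y \<in> fmod (r 0). d0 y = 0} s0 {v \<in> fmod s0. d0' v = 0}"
      by (rule resolution_step[OF X X order_refl Y \<alpha> \<beta> \<alpha>Y \<beta>X d0(1,2) G j split])
    \<comment> \<open>The constant rank and the zero differentials are placeholders in positive
      degrees, overwritten as the induction proceeds.\<close>
    then have "is_resolution 0 UNIV fmod (free_act multC) X actX (\<lambda>_. s0) d0' (\<lambda>_ _. 0) \<and>
        comparison (r 0) (syzygy fmod r d0 d 0) s0 (syzygy fmod (\<lambda>_. s0) d0' (\<lambda>_ _. 0) 0)"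
      by (simp add: is_resolution_def syzygy_def)
    then show ?case by blast
  next
    case (Suc k)
    from Suc.IH[OF Suc_leD[OF Suc.prems]] obtain s d0' d' where
      IH: "is_resolution k UNIV fmod (free_act multC) X actX s d0' d'" and
      cmp: "comparison (r k) (syzygy fmod r d0 d k) (s k) (syzygy fmod s d0' d' k)"
      by blast
    from cmp obtain a b g where
      a: "is_hom UNIV (fmod (r k)) (free_act multB) (fmod (s k)) (restrict_scalars psi (free_act multC)) a" and
      b: "is_hom UNIV (fmod (s k)) (free_act multC) (fmod (r k)) (restrict_scalars phi (free_act multB)) b" and
      a_syz: "a ` syzygy fmod r d0 d k \<subseteq> syzygy fmod s d0' d' k" and
      b_syz: "b ` syzygy fmod s d0' d' k \<subseteq> syzygy fmod r d0 d k" and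
      g: "is_hom UNIV (fmod (s k)) (free_act multC) (syzygy fmod s d0' d' k) (free_act multC) g" and
      abg: "\<forall>v\<in>syzygy fmod s d0' d' k. a (b v) + g v = v"
      unfolding comparison_def by (elim exE conjE) (rule that)
    \<comment> \<open>The syzygies are the kernel of the augmentation in degree 0 and of a
      differential between free modules afterwards.\<close>
    have syz: "monoid_module multC oneC (syzygy fmod s d0' d' k) (free_act multC)"
    proof (cases k)
      case 0
      then have "is_hom UNIV (fmod (s k)) (free_act multC) X actX d0'"
        using IH by (simp add: is_resolution_def)
      then show ?thesis using monoid_module_kernel[OF FC X] 0 by (simp add: syzygy_def)
    next
      case (Suc i)
      then have "is_hom UNIV (fmod (s k)) (free_act multC) (fmod (s i)) (free_act multC) (d' k)"
        using IH by (simp add: is_resolution_def)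
      then show ?thesis using monoid_module_kernel[OF FC FC] Suc by (simp add: syzygy_def)
    qed
    have syz_sub: "syzygy fmod s d0' d' k \<subseteq> fmod (s k)" by (auto simp: syzygy_def)
    have dS: "is_hom UNIV (fmod (r (Suc k))) (free_act multB) (fmod (r k)) (free_act multB) (d (Suc k))"
      "d (Suc k) ` fmod (r (Suc k)) = syzygy fmod r d0 d k"
      using res Suc.prems by (simp_all add: is_resolution_def)
    have idh: "is_hom UNIV (fmod (s k)) (free_act multC) (fmod (s k)) (free_act multC) (\<lambda>v::nat \<Rightarrow> 'l \<Rightarrow> 'k. v)"
      by (simp add: is_hom_def)
    \<comment> \<open>Here \<open>t\<close> is \<open>s k\<close>: a copy of the preceding free
      module is added, mapped to the syzygies by \<open>g\<close>.\<close>
    obtain s1 d1 where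
      d1: "is_hom UNIV (fmod s1) (free_act multC) (fmod (s k)) (free_act multC) d1"
        "d1 ` fmod s1 = syzygy fmod s d0' d' k" and
      cmp1: "comparison (r (Suc k)) {y \<in> fmod (r (Suc k)). d (Suc k) y = 0} s1 {v \<in> fmod s1. d1 v = 0}"
      by (rule resolution_step[where G = g and j = "\<lambda>v. v" and \<alpha> = a and \<beta> = b,
            OF FC[of "s k"] syz syz_sub FB[of "r k"] a b a_syz b_syz dS(1,2) g idh abg[rule_format]])
    \<comment> \<open>Updating only at \<open>Suc k\<close> keeps everything built up to degree
      \<open>k\<close>, including its syzygies.\<close>
    define s' where "s' = s(Suc k := s1)"
    define d'' where "d'' = d'(Suc k := d1)"
    have same: "s' i = s i" "d'' i = d' i" if "i \<le> k" for i
      using that by (simp_all add: s'_def d''_def)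
    have syz_same: "syzygy fmod s' d0' d'' i = syzygy fmod s d0' d' i" if "i \<le> k" for i
      using that by (simp add: syzygy_def same)
    have new: "s' (Suc k) = s1" "d'' (Suc k) = d1" by (simp_all add: s'_def d''_def)
    have "is_resolution (Suc k) UNIV fmod (free_act multC) X actX s' d0' d''"
      using IH d1 by (auto simp: is_resolution_def less_Suc_eq same syz_same new)
    moreover have "comparison (r (Suc k)) (syzygy fmod r d0 d (Suc k)) (s' (Suc k))
        (syzygy fmod s' d0' d'' (Suc k))"
      using cmp1 by (simp add: syzygy_def new)
    ultimately show ?case by blast
  qed
  then show ?thesis unfolding has_FPn_resolution_iff by blast
qed

end

section \<open>Translation of the four finiteness properties\<close>

text \<open>A scalar acts as the sum of its monomials and \<open>f\<close> is additive, so commuting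
  with monomials suffices; conversely each monomial arises from some scalar in
  \<open>S\<close>.\<close>

lemma is_hom_coefficients:
  fixes coef :: "'s \<Rightarrow> 'm \<Rightarrow> 'k::comm_ring_1"
  assumes P: "monoid_module mult one P actP'" and M: "monoid_module mult one M actM'"
    and actP: "\<And>s x. s \<in> S \<Longrightarrow> x \<in> P \<Longrightarrow> actP s x = (\<Sum>m\<in>supp_fn (coef s). actP' (coef s m, m) x)"
    and actM: "\<And>s x. s \<in> S \<Longrightarrow> x \<in> M \<Longrightarrow> actM s x = (\<Sum>m\<in>supp_fn (coef s). actM' (coef s m, m) x)"
    and single: "\<And>k m. \<exists>s\<in>S. coef s = single m k"
  shows "is_hom S P actP M actM f \<longleftrightarrow> is_hom UNIV P actP' M actM' f"
proof
  interpret P: monoid_module mult one P actP' by fact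
  interpret M: monoid_module mult one M actM' by fact
  {
    assume f: "is_hom S P actP M actM f"
    have "f (actP' (k, m) x) = actM' (k, m) (f x)" if "x \<in> P" for k m x
    proof -
      from single obtain s where s: "s \<in> S" "coef s = single m k" by blast
      have fx: "f x \<in> M" using f that unfolding is_hom_def by blast
      \<comment> \<open>For \<open>k = 0\<close> the support is empty, and the sum agrees with the
        monomial because the zero scalar acts as zero.\<close>
      have supp: "supp_fn (single m k) = (if k = 0 then {} else {m})"
        by (auto simp: supp_fn_def single_def)
      have "actP s x = actP' (k, m) x"
        using actP[OF s(1) that] s(2) P.act_zero_scalar[OF that] by (simp add: supp) (simp add: single_def)
      moreover have "actM s (f x) = actM' (k, m) (f x)"
        using actM[OF s(1) fx] s(2) M.act_zero_scalar[OF fx] by (simp add: supp) (simp add: single_def)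
      moreover have "f (actP s x) = actM s (f x)" using f s(1) that unfolding is_hom_def by blast
      ultimately show ?thesis by metis
    qed
    then show "is_hom UNIV P actP' M actM' f" using f unfolding is_hom_def by auto
  next
    assume f: "is_hom UNIV P actP' M actM' f"
    have "f (actP s x) = actM s (f x)" if s: "s \<in> S" and x: "x \<in> P" for s x
    proof -
      have fx: "f x \<in> M" using f x unfolding is_hom_def by blast
      have "f (actP s x) = (\<Sum>m\<in>supp_fn (coef s). f (actP' (coef s m, m) x))"
        unfolding actP[OF s x]
        by (rule is_hom_sum[OF f P.zero_mem P.add_mem P.act_mem[OF x], THEN conjunct1])
      also have "\<dots> = (\<Sum>m\<in>supp_fn (coef s). actM' (coef s m, m) (f x))"
        using f x unfolding is_hom_def by (intro sum.cong) blast+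
      also have "\<dots> = actM s (f x)" using actM[OF s fx] by simp
      finally show ?thesis .
    qed
    then show "is_hom S P actP M actM f" using f unfolding is_hom_def by blast
  }
qed

text \<open>Scalars enter the notion of a resolution only through \<open>is_hom\<close>, so the same
  ranks and maps serve both sides.\<close>

lemma has_FPn_resolution_coefficients:
  fixes coef :: "'s \<Rightarrow> 'm \<Rightarrow> 'k::comm_ring_1"
  assumes M: "monoid_module mult one M actM'"
    and actF: "\<And>s r v. s \<in> S \<Longrightarrow> v \<in> fmod r \<Longrightarrow>
      actF s v = (\<Sum>m\<in>supp_fn (coef s). free_act mult (coef s m, m) v)"
    and actM: "\<And>s x. s \<in> S \<Longrightarrow> x \<in> M \<Longrightarrow> actM s x = (\<Sum>m\<in>supp_fn (coef s). actM' (coef s m, m) x)"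
    and single: "\<And>k m. \<exists>s\<in>S. coef s = single m k"
  shows "has_FPn_resolution n S fmod actF M actM
    \<longleftrightarrow> has_FPn_resolution n UNIV fmod (free_act mult) M actM'"
proof -
  have F: "monoid_module mult one (fmod r) (free_act mult :: 'k \<times> 'm \<Rightarrow> _)" for r
    using M by (intro monoid_module_fmod) (simp add: monoid_module_def)
  have "is_hom S (fmod r) actF M actM f \<longleftrightarrow> is_hom UNIV (fmod r) (free_act mult) M actM' f" for r f
    by (rule is_hom_coefficients[OF F M actF actM single])
  moreover have "is_hom S (fmod r) actF (fmod r') actF f
      \<longleftrightarrow> is_hom UNIV (fmod r) (free_act mult) (fmod r') (free_act mult) f" for r r' f
    by (rule is_hom_coefficients[OF F F actF actF single])
  ultimately show ?thesis unfolding has_FPn_resolution_def by simp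
qed

section \<open>Monoid ring products as sums of translations\<close>

lemma sum_supp_fn_superset:
  assumes "finite A" "supp_fn a \<subseteq> A" "\<And>m. f 0 m = 0"
  shows "(\<Sum>m\<in>supp_fn a. f (a m) m) = (\<Sum>m\<in>A. f (a m) m)"
  by (rule sum.mono_neutral_left) (use assms in \<open>auto simp: supp_fn_def\<close>)

lemma mr_mult_eq_sum:
  assumes "finite (supp_fn a)" "finite (supp_fn b)"
  shows "mr_mult a b x = (\<Sum>u\<in>supp_fn a. \<Sum>v\<in>supp_fn b. if u * v = x then a u * b v else 0)"
  unfolding mr_mult_def sum.cartesian_product
  by (rule sum.mono_neutral_cong_left) (use assms in \<open>auto split: if_splits\<close>)

lemma mr_mult_eq_sum_push_left:
  assumes "finite (supp_fn a)" "finite (supp_fn b)"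
  shows "mr_mult a b = (\<Sum>u\<in>supp_fn a. push (\<lambda>y. u * y) (a u) b)"
  by (rule ext) (simp add: mr_mult_eq_sum[OF assms] sum_fun_apply push_eq_sum[OF assms(2) order_refl])

lemma mr_mult_eq_sum_push_right:
  assumes "finite (supp_fn a)" "finite (supp_fn b)"
  shows "mr_mult a b = (\<Sum>u\<in>supp_fn b. push (\<lambda>y. y * u) (b u) a)"
proof
  fix x
  show "mr_mult a b x = (\<Sum>u\<in>supp_fn b. push (\<lambda>y. y * u) (b u) a) x"
    unfolding mr_mult_eq_sum[OF assms] sum_fun_apply push_eq_sum[OF assms(1) order_refl]
    by (subst sum.swap) (simp add: mult.commute cong: if_cong)
qed

text \<open>Left translations followed by right translations compose, by \<open>push_push\<close>,
  to two-sided ones.\<close>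

lemma mr_mult_mr_mult_eq_sum_push:
  assumes "finite (supp_fn a)" "finite (supp_fn b)" "finite (supp_fn f)"
  shows "mr_mult (mr_mult a f) b
    = (\<Sum>(u, v)\<in>supp_fn a \<times> supp_fn b. push (\<lambda>y. u * y * v) (a u * b v) f)"
proof -
  let ?g = "\<Sum>u\<in>supp_fn a. push (\<lambda>y. u * y) (a u) f"
  have fin: "finite (supp_fn (push (\<lambda>y. u * y) (a u) f))" for u
    by (rule finite_supp_push[OF assms(3)])
  have fin_g: "finite (supp_fn ?g)" by (rule push_sum[OF assms(1) fin, THEN conjunct2])
  have "mr_mult (mr_mult a f) b = (\<Sum>v\<in>supp_fn b. push (\<lambda>y. y * v) (b v) ?g)"
    using mr_mult_eq_sum_push_right[OF fin_g assms(2)] mr_mult_eq_sum_push_left[OF assms(1,3)] by simp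
  also have "\<dots> = (\<Sum>v\<in>supp_fn b. \<Sum>u\<in>supp_fn a. push (\<lambda>y. u * y * v) (a u * b v) f)"
    by (rule sum.cong) (simp_all add: push_sum[OF assms(1) fin] push_push[OF assms(3)] comp_def mult.commute)
  also have "\<dots> = (\<Sum>(u, v)\<in>supp_fn a \<times> supp_fn b. push (\<lambda>y. u * y * v) (a u * b v) f)"
    by (subst sum.swap) (rule sum.cartesian_product)
  finally show ?thesis .
qed

lemma tens_act_eq_sum_push:
  assumes "finite (supp_fn a)" "finite (supp_fn b)" "finite (supp_fn w)"
  shows "tens_act (a, b) w
    = (\<Sum>(u, v)\<in>supp_fn a \<times> supp_fn b. push (\<lambda>(p, q). (u * p, q * v)) (a u * b v) w)"
proof (rule ext, clarify)
  fix x y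
  let ?h = "\<lambda>(u, p, q, v). ((u, v), (p, q))"
  let ?f = "\<lambda>(u, v) (p, q). if (u * p, q * v) = (x, y) then a u * b v * w (p, q) else 0"
  have "tens_act (a, b) w (x, y)
      = (\<Sum>(u, p, q, v)\<in>{(u, p, q, v). u \<in> supp_fn a \<and> (p, q) \<in> supp_fn w \<and> v \<in> supp_fn b \<and>
          u * p = x \<and> q * v = y}. a u * w (p, q) * b v)"
    by (simp add: tens_act_def)
  also have "\<dots> = (\<Sum>((u, v), (p, q))\<in>{((u, v), (p, q)). u \<in> supp_fn a \<and> (p, q) \<in> supp_fn w \<and>
          v \<in> supp_fn b \<and> u * p = x \<and> q * v = y}. a u * b v * w (p, q))"
    \<comment> \<open>Rebracketing separates the acting pair \<open>(u, v)\<close> from the point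
      \<open>(p, q)\<close>, so that the inner sum becomes a \<open>push\<close>.\<close>
    by (rule sum.reindex_bij_witness[where j = ?h and i = "\<lambda>((u, v), (p, q)). (u, p, q, v)"])
      (auto simp: mult_ac)
  also have "\<dots> = (\<Sum>(t, z)\<in>(supp_fn a \<times> supp_fn b) \<times> supp_fn w. ?f t z)"
    by (rule sum.mono_neutral_cong_left) (use assms in \<open>auto split: if_splits\<close>)
  also have "\<dots> = (\<Sum>t\<in>supp_fn a \<times> supp_fn b. \<Sum>z\<in>supp_fn w. ?f t z)"
    by (rule sum.cartesian_product[symmetric])
  also have "\<dots> = (\<Sum>(u, v)\<in>supp_fn a \<times> supp_fn b. push (\<lambda>(p, q). (u * p, q * v)) (a u * b v) w) (x, y)"
    unfolding sum_fun_apply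
    by (rule sum.cong) (auto simp: push_eq_sum[OF assms(3) order_refl] intro!: sum.cong)
  finally show "tens_act (a, b) w (x, y)
    = (\<Sum>(u, v)\<in>supp_fn a \<times> supp_fn b. push (\<lambda>(p, q). (u * p, q * v)) (a u * b v) w) (x, y)" .
qed

section \<open>Bimodules as modules over the enveloping monoid\<close>

lemma mem_monring: "f \<in> monring \<longleftrightarrow> finite (supp_fn f)"
  by (simp add: monring_def supp_fn_def)

lemma free_mod_eq_fmod: "free_mod = fmod"
  by (rule ext) (auto simp: free_mod_def fmod_def mem_monring)

lemma free_bimod_eq_fmod: "free_bimod = fmod"
  by (rule ext) (auto simp: free_bimod_def fmod_def)

text \<open>Multiplication of the enveloping monoid: the second factor is reversed, which turns
  bimodules into left modules.\<close>

definition env_mult :: "'b::monoid_mult \<times> 'b \<Rightarrow> 'b \<times> 'b \<Rightarrow> 'b \<times> 'b" where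
  "env_mult s t = (fst s * fst t, snd t * snd s)"

text \<open>Coefficients of the pure tensor of the two components in the algebra of the enveloping
  monoid.\<close>

definition env_coef :: "('b \<Rightarrow> 'k::comm_ring_1) \<times> ('b \<Rightarrow> 'k) \<Rightarrow> 'b \<times> 'b \<Rightarrow> 'k" where
  "env_coef s t = fst s (fst t) * snd s (snd t)"

text \<open>A monomial with coefficient \<open>k\<close> has augmentation \<open>k\<close>, so this
  is the action on K in the left, right and two-sided case alike.\<close>

definition triv_act :: "'k::comm_ring_1 \<times> 'm \<Rightarrow> 'k \<Rightarrow> 'k" where
  "triv_act s x = fst s * x"

definition two_sided_act :: "'k::comm_ring_1 \<times> ('b::monoid_mult \<times> 'b) \<Rightarrow> ('b \<Rightarrow> 'k) \<Rightarrow> 'b \<Rightarrow> 'k" where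
  "two_sided_act s f = push (\<lambda>y. fst (snd s) * y * snd (snd s)) (fst s) f"

lemma env_mult_fun: "env_mult (u, v) = (\<lambda>(p, q). (u * p, q * v))"
  by (auto simp: env_mult_def)

lemma monoid_op: "monoid (\<lambda>x y :: 'b::monoid_mult. y * x) 1"
  by unfold_locales (auto simp: mult.assoc)

lemma monoid_env: "monoid (env_mult :: 'b::monoid_mult \<times> 'b \<Rightarrow> _) (1, 1)"
  by unfold_locales (auto simp: env_mult_def mult.assoc)

lemma monoid_module_triv: "monoid mult one \<Longrightarrow> monoid_module mult one (UNIV :: 'k::comm_ring_1 set) triv_act"
  by (auto simp: monoid_module_def monoid_module_axioms_def triv_act_def algebra_simps)

lemma monoid_module_two_sided:
  "monoid_module env_mult (1, 1) (monring :: ('b::monoid_mult \<Rightarrow> 'k::comm_ring_1) set) two_sided_act"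
proof -
  interpret monoid "env_mult :: 'b \<times> 'b \<Rightarrow> _" "(1, 1)" by (rule monoid_env)
  show ?thesis
    by unfold_locales
      (auto simp: mem_monring two_sided_act_def finite_supp_add finite_supp_push push_add
        push_add_scalar push_push push_id env_mult_def comp_def mult.assoc)
qed

text \<open>Only an inclusion holds in general: with zero divisors in K a product of nonzero
  coefficients may vanish. \<open>sum_supp_fn_superset\<close> bridges the gap.\<close>

lemma env_coef_supp: "supp_fn (env_coef (a, b)) \<subseteq> supp_fn a \<times> supp_fn b"
  by (auto simp: supp_fn_def env_coef_def)

lemma push_zero_scalar [simp]: "push h 0 f = 0"
  by (rule ext) (simp add: push_def)

section \<open>The four properties over monoid algebras\<close>

lemma left_FP_iff:
  "left_FP TYPE('k::comm_ring_1) TYPE('b::monoid_mult) n \<longleftrightarrow>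
    has_FPn_resolution n UNIV fmod (free_act ((*) :: 'b \<Rightarrow> _)) (UNIV :: 'k set) triv_act"
  unfolding left_FP_def free_mod_eq_fmod
proof (rule has_FPn_resolution_coefficients[where coef = "\<lambda>a. a"])
  show "monoid_module (*) (1 :: 'b) (UNIV :: 'k set) triv_act"
    by (rule monoid_module_triv) (rule mult.monoid_axioms)
  fix a :: "'b \<Rightarrow> 'k" assume a: "a \<in> monring"
  show "lact a v = (\<Sum>m\<in>supp_fn a. free_act (*) (a m, m) v)" if "v \<in> fmod r" for r v
  proof
    fix i
    show "lact a v i = (\<Sum>m\<in>supp_fn a. free_act (*) (a m, m) v) i"
      by (rule trans[OF _ sum_fun_apply[symmetric]])
        (use a that in \<open>simp add: lact_def free_act_def mem_monring fmod_def mr_mult_eq_sum_push_left\<close>)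
  qed
  show "aug a * x = (\<Sum>m\<in>supp_fn a. triv_act (a m, m) x)" for x
    by (simp add: aug_def triv_act_def sum_distrib_right)
next
  show "\<exists>a\<in>monring. a = single m k" for m :: 'b and k :: 'k
    by (simp add: mem_monring)
qed

lemma right_FP_iff:
  "right_FP TYPE('k::comm_ring_1) TYPE('b::monoid_mult) n \<longleftrightarrow>
    has_FPn_resolution n UNIV fmod (free_act (\<lambda>x y :: 'b. y * x)) (UNIV :: 'k set) triv_act"
  unfolding right_FP_def free_mod_eq_fmod
proof (rule has_FPn_resolution_coefficients[where coef = "\<lambda>a. a"])
  show "monoid_module (\<lambda>x y. y * x) (1 :: 'b) (UNIV :: 'k set) triv_act"
    by (rule monoid_module_triv) (rule monoid_op)
  fix a :: "'b \<Rightarrow> 'k" assume a: "a \<in> monring"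
  show "ract a v = (\<Sum>m\<in>supp_fn a. free_act (\<lambda>x y. y * x) (a m, m) v)" if "v \<in> fmod r" for r v
  proof
    fix i
    show "ract a v i = (\<Sum>m\<in>supp_fn a. free_act (\<lambda>x y. y * x) (a m, m) v) i"
      by (rule trans[OF _ sum_fun_apply[symmetric]])
        (use a that in \<open>simp add: ract_def free_act_def mem_monring fmod_def mr_mult_eq_sum_push_right\<close>)
  qed
  show "x * aug a = (\<Sum>m\<in>supp_fn a. triv_act (a m, m) x)" for x
    by (simp add: aug_def triv_act_def sum_distrib_left mult.commute)
next
  show "\<exists>a\<in>monring. a = single m k" for m :: 'b and k :: 'k
    by (simp add: mem_monring)
qed

lemma biact_eq_sum:
  assumes "s \<in> monring \<times> monring" "v \<in> fmod r"
  shows "biact s v = (\<Sum>m\<in>supp_fn (env_coef s). free_act env_mult (env_coef s m, m) v)"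
proof
  fix i
  obtain a b where s: "s = (a, b)" by fastforce
  have fin: "finite (supp_fn a)" "finite (supp_fn b)" "finite (supp_fn (v i))"
    using assms by (auto simp: s mem_monring fmod_def)
  have "(\<Sum>m\<in>supp_fn (env_coef s). free_act env_mult (env_coef s m, m) v) i
      = (\<Sum>m\<in>supp_fn (env_coef s). push (env_mult m) (env_coef s m) (v i))"
    by (rule trans[OF sum_fun_apply]) (simp add: free_act_def)
  also have "\<dots> = (\<Sum>m\<in>supp_fn a \<times> supp_fn b. push (env_mult m) (env_coef s m) (v i))"
    by (rule sum_supp_fn_superset[where f = "\<lambda>k m. push (env_mult m) k (v i)"])
      (use fin env_coef_supp in \<open>auto simp: s\<close>)
  also have "\<dots> = tens_act s (v i)"
    unfolding s tens_act_eq_sum_push[OF fin]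
    by (rule sum.cong) (auto simp: env_mult_fun env_coef_def)
  finally show "biact s v i = (\<Sum>m\<in>supp_fn (env_coef s). free_act env_mult (env_coef s m, m) v) i"
    by (simp add: biact_def)
qed

text \<open>Bimodule scalars are pairs, hence only pure tensors, but these already include every
  monomial.\<close>

lemma env_coef_single:
  "\<exists>s\<in>monring \<times> monring. env_coef s = single m (k :: 'k::comm_ring_1)"
proof -
  have "env_coef (single (fst m) k, single (snd m) 1) = single m k"
    by (rule ext) (auto simp: env_coef_def single_def prod_eq_iff)
  then show ?thesis by (intro bexI) (auto simp: mem_monring)
qed

lemma weak_bi_FP_iff:
  "weak_bi_FP TYPE('k::comm_ring_1) TYPE('b::monoid_mult) n \<longleftrightarrow>
    has_FPn_resolution n UNIV fmod (free_act (env_mult :: 'b \<times> 'b \<Rightarrow> _)) (UNIV :: 'k set) triv_act"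
  unfolding weak_bi_FP_def free_bimod_eq_fmod
proof (rule has_FPn_resolution_coefficients[where coef = env_coef,
      OF _ biact_eq_sum _ env_coef_single])
  show "monoid_module env_mult (1 :: 'b, 1 :: 'b) (UNIV :: 'k set) triv_act"
    by (rule monoid_module_triv) (rule monoid_env)
  fix s :: "('b \<Rightarrow> 'k) \<times> ('b \<Rightarrow> 'k)" and x :: 'k assume "s \<in> monring \<times> monring"
  then obtain a b where s: "s = (a, b)" and fin: "finite (supp_fn a)" "finite (supp_fn b)"
    by (auto simp: mem_monring)
  have "(\<Sum>m\<in>supp_fn (env_coef s). triv_act (env_coef s m, m) x)
      = (\<Sum>m\<in>supp_fn a \<times> supp_fn b. triv_act (env_coef s m, m) x)"
    by (rule sum_supp_fn_superset[where f = "\<lambda>k m. triv_act (k, m) x"])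
      (use fin env_coef_supp in \<open>auto simp: s triv_act_def\<close>)
  also have "\<dots> = aug a * aug b * x"
  proof -
    have "aug a * aug b = (\<Sum>m\<in>supp_fn a \<times> supp_fn b. env_coef s m)"
      by (simp add: s aug_def env_coef_def sum_product sum.cartesian_product split_def)
    then show ?thesis by (simp add: triv_act_def sum_distrib_right)
  qed
  finally show "aug (fst s) * x * aug (snd s) = (\<Sum>m\<in>supp_fn (env_coef s). triv_act (env_coef s m, m) x)"
    by (simp add: s mult_ac)
qed

lemma bi_FP_iff:
  "bi_FP TYPE('k::comm_ring_1) TYPE('b::monoid_mult) n \<longleftrightarrow>
    has_FPn_resolution n UNIV fmod (free_act env_mult) (monring :: ('b \<Rightarrow> 'k) set) two_sided_act"
  unfolding bi_FP_def free_bimod_eq_fmod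
proof (rule has_FPn_resolution_coefficients[where coef = env_coef,
      OF monoid_module_two_sided biact_eq_sum _ env_coef_single])
  fix s :: "('b \<Rightarrow> 'k) \<times> ('b \<Rightarrow> 'k)" and f :: "'b \<Rightarrow> 'k"
  assume "s \<in> monring \<times> monring" "f \<in> monring"
  then obtain a b where s: "s = (a, b)"
    and fin: "finite (supp_fn a)" "finite (supp_fn b)" "finite (supp_fn f)"
    by (auto simp: mem_monring)
  have "(\<Sum>m\<in>supp_fn (env_coef s). two_sided_act (env_coef s m, m) f)
      = (\<Sum>m\<in>supp_fn a \<times> supp_fn b. two_sided_act (env_coef s m, m) f)"
    by (rule sum_supp_fn_superset[where f = "\<lambda>k m. two_sided_act (k, m) f"])
      (use fin env_coef_supp in \<open>auto simp: s two_sided_act_def\<close>)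
  also have "\<dots> = mr_mult (mr_mult a f) b"
    unfolding s mr_mult_mr_mult_eq_sum_push[OF fin]
    by (rule sum.cong) (auto simp: two_sided_act_def env_coef_def)
  finally show "mr_mult (mr_mult (fst s) f) (snd s)
      = (\<Sum>m\<in>supp_fn (env_coef s). two_sided_act (env_coef s m, m) f)"
    by (simp add: s)
qed

theorem theorem3:
  fixes psi :: "'b::monoid_mult \<Rightarrow> 'c::monoid_mult" and phi :: "'c \<Rightarrow> 'b" and n :: nat
  assumes "monoid_hom psi" and "monoid_hom phi" and "\<And>c. psi (phi c) = c"
  shows "(left_FP TYPE('k::comm_ring_1) TYPE('b) n \<longrightarrow> left_FP TYPE('k) TYPE('c) n) \<and>
         (right_FP TYPE('k) TYPE('b) n \<longrightarrow> right_FP TYPE('k) TYPE('c) n) \<and>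
         (bi_FP TYPE('k) TYPE('b) n \<longrightarrow> bi_FP TYPE('k) TYPE('c) n) \<and>
         (weak_bi_FP TYPE('k) TYPE('b) n \<longrightarrow> weak_bi_FP TYPE('k) TYPE('c) n)"
proof -
  have psi: "psi 1 = 1" "\<And>x y. psi (x * y) = psi x * psi y"
    and phi: "phi 1 = 1" "\<And>x y. phi (x * y) = phi x * phi y"
    using assms(1,2) by (auto simp: monoid_hom_def)
  \<comment> \<open>The given retraction induces one of the opposite monoids and, componentwise, one
    of the enveloping monoids.\<close>
  interpret L: retract_pair "(*)" 1 "(*)" 1 psi phi
    by unfold_locales (auto simp: psi phi assms(3))
  interpret R: retract_pair "\<lambda>x y. y * x" 1 "\<lambda>x y. y * x" 1 psi phi
    by unfold_locales (auto simp: psi phi assms(3) mult.assoc)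
  interpret E: retract_pair env_mult "(1, 1)" env_mult "(1, 1)" "map_prod psi psi" "map_prod phi phi"
    by unfold_locales (auto simp: psi phi assms(3) env_mult_def mult.assoc)
  \<comment> \<open>Monoid homomorphisms preserve augmentation, so on K the identity serves as both
    comparison maps.\<close>
  have triv: "is_hom UNIV (UNIV :: 'k set) triv_act UNIV (restrict_scalars h triv_act) (\<lambda>x. x)"
    for h :: "'x \<Rightarrow> 'y"
    by (auto simp: is_hom_def restrict_scalars_def triv_act_def)
  \<comment> \<open>For bi-FP the comparison maps are the ring maps between KB and KC induced by
    \<open>psi\<close> and \<open>phi\<close>.\<close>
  have push_hom: "is_hom UNIV (monring :: ('x \<Rightarrow> 'k) set) two_sided_act (monring :: ('y \<Rightarrow> 'k) set)
      (restrict_scalars (map_prod h h) two_sided_act) (push h 1)"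
    if "\<And>x y. h (x * y) = h x * h y" for h :: "'x::monoid_mult \<Rightarrow> 'y::monoid_mult"
    using that by (auto simp: is_hom_def restrict_scalars_def two_sided_act_def mem_monring
        finite_supp_push push_add push_push comp_def)
  have push_retract: "push psi 1 (push phi 1 f) = f" if "f \<in> monring" for f :: "'c \<Rightarrow> 'k"
    using that by (simp add: mem_monring push_push push_id comp_def assms(3))
  have "left_FP TYPE('k) TYPE('b) n \<longrightarrow> left_FP TYPE('k) TYPE('c) n"
    unfolding left_FP_iff
    by (intro impI, rule L.has_FPn_resolution_transfer[OF _ _ triv triv])
      (auto intro: monoid_module_triv mult.monoid_axioms)
  moreover have "right_FP TYPE('k) TYPE('b) n \<longrightarrow> right_FP TYPE('k) TYPE('c) n"
    unfolding right_FP_iff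
    by (intro impI, rule R.has_FPn_resolution_transfer[OF _ _ triv triv])
      (auto intro: monoid_module_triv monoid_op)
  moreover have "weak_bi_FP TYPE('k) TYPE('b) n \<longrightarrow> weak_bi_FP TYPE('k) TYPE('c) n"
    unfolding weak_bi_FP_iff
    by (intro impI, rule E.has_FPn_resolution_transfer[OF _ _ triv triv])
      (auto intro: monoid_module_triv monoid_env)
  moreover have "bi_FP TYPE('k) TYPE('b) n \<longrightarrow> bi_FP TYPE('k) TYPE('c) n"
    unfolding bi_FP_iff
    by (intro impI, rule E.has_FPn_resolution_transfer[where \<alpha> = "push psi 1" and \<beta> = "push phi 1", OF monoid_module_two_sided
          monoid_module_two_sided push_hom[OF psi(2)] push_hom[OF phi(2)] push_retract])
  ultimately show ?thesis by blast
qed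

end
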